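(* For every integer $m\ge 6$, $$D(f_m)=\frac{m-11}{5}f_{m-1}+\frac{m+1}{5}f_{m-3}+m+1.$$
   Context: The Fibonacci sequence $\mathbb{F}$ is the infinite word over $\{a,b\}$ that is the fixed point beginning with $a$ of the morphism $\sigma(a)=ab$, $\sigma(b)=a$; $\mathbb{F}[1,n]$ is its prefix of length $n$. For a nonempty factor $\omega$ of $\mathbb{F}$, $\omega_p$ denotes its $p$-th occurrence in $\mathbb{F}$; $\omega_p\omega_{p+1}\omega_{p+2}\prec\mathbb{F}[1,n]$ means that the $p$-th, $(p+1)$-th and $(p+2)$-th occurrences of $\omega$ are consecutive and adjacent (each starts right after the previous one ends) and all lie inside $\mathbb{F}[1,n]$. $D(n)=\sharp\{(\omega,p):\omega_p\omega_{p+1}\omega_{p+2}\prec\mathbb{F}[1,n]\}$ is the number of repeated cubes (cube occurrences) in $\mathbb{F}[1,n]$. The Fibonacci numbers are indexed by $f_{-2}=0$, $f_{-1}=1$, $f_{m+1}=f_m+f_{m-1}$ for $m\ge -1$ (so $f_0=1$, $f_1=2$, $f_2=3$, $f_3=5$). *)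

theory Defs
  imports Complex_Main "HOL-Library.Infinite_Set" "HOL-Number_Theory.Fib"
begin

datatype letter = A | B

fun sigma_letter :: "letter \<Rightarrow> letter list" where
  "sigma_letter A = [A, B]"
| "sigma_letter B = [A]"

definition sigma :: "letter list \<Rightarrow> letter list" where
  "sigma w = concat (map sigma_letter w)"

text \<open>Infinite words are functions on the naturals, with positions counted from 0.
  \<^term>\<open>subword x i l\<close> is the factor of length \<^term>\<open>l\<close> of \<^term>\<open>x\<close> starting at position \<^term>\<open>i\<close>.\<close>

definition subword :: "(nat \<Rightarrow> 'a) \<Rightarrow> nat \<Rightarrow> nat \<Rightarrow> 'a list" where
  "subword x i l = map x [i..<i + l]"

text \<open>The morphism extended to infinite words. As \<^term>\<open>sigma\<close> is non-erasing, letter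
  \<^term>\<open>i\<close> of the image is already determined by the first \<^term>\<open>Suc i\<close> letters.\<close>

definition sigma_inf :: "(nat \<Rightarrow> letter) \<Rightarrow> nat \<Rightarrow> letter" where
  "sigma_inf x i = sigma (subword x 0 (Suc i)) ! i"

definition fib_word :: "nat \<Rightarrow> letter" where
  "fib_word = (THE x. sigma_inf x = x \<and> x 0 = A)"

definition occs :: "letter list \<Rightarrow> nat set" where
  "occs w = {i. subword fib_word i (length w) = w}"

definition factor :: "letter list \<Rightarrow> bool" where
  "factor w \<longleftrightarrow> occs w \<noteq> {}"

text \<open>Start position of the \<^term>\<open>p\<close>-th occurrence (\<^term>\<open>p \<ge> 1\<close>) of a factor;
  \<^const>\<open>enumerate\<close> counts from 0 and is only meaningful on infinite sets,
  see \<open>infinite_occs\<close> below.\<close>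

definition occ_pos :: "letter list \<Rightarrow> nat \<Rightarrow> nat" where
  "occ_pos w p = enumerate (occs w) (p - 1)"

definition cube_in_prefix :: "letter list \<Rightarrow> nat \<Rightarrow> nat \<Rightarrow> bool" where
  "cube_in_prefix w p n \<longleftrightarrow>
     occ_pos w (p + 1) = occ_pos w p + length w \<and>
     occ_pos w (p + 2) = occ_pos w (p + 1) + length w \<and>
     occ_pos w (p + 2) + length w \<le> n"

definition cube_set :: "nat \<Rightarrow> (letter list \<times> nat) set" where
  "cube_set n = {(w, p). w \<noteq> [] \<and> factor w \<and> 1 \<le> p \<and> cube_in_prefix w p n}"

definition D :: "nat \<Rightarrow> nat" where
  "D n = card (cube_set n)"

text \<open>Fibonacci numbers with the indexing $f_{-2} = 0$, $f_{-1} = 1$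
  (only meaningful for indices at least $-2$).\<close>

definition f :: "int \<Rightarrow> nat" where
  "f k = fib (nat (k + 2))"

lemma f_base: "f (-2) = 0" "f (-1) = 1"
  by (simp_all add: f_def)

lemma f_rec: "m \<ge> -1 \<Longrightarrow> f (m + 1) = f m + f (m - 1)"
proof -
  assume "m \<ge> -1"
  then have "nat (m + 1 + 2) = Suc (Suc (nat (m - 1 + 2)))" "nat (m + 2) = Suc (nat (m - 1 + 2))"
    by linarith+
  then show ?thesis unfolding f_def by simp
qed


subsection \<open>Well-definedness\<close>

lemma sigma_Nil [simp]: "sigma [] = []"
  and sigma_Cons [simp]: "sigma (c # w) = sigma_letter c @ sigma w"
  and sigma_append [simp]: "sigma (u @ v) = sigma u @ sigma v"
  by (simp_all add: sigma_def)

lemma sigma_pow_append: "(sigma ^^ k) (u @ v) = (sigma ^^ k) u @ (sigma ^^ k) v"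
  by (induction k) auto

lemma length_sigma_letter: "length (sigma_letter c) \<ge> 1"
  by (cases c) auto

lemma sigma_letter_not_Nil: "sigma_letter c \<noteq> []"
  by (cases c) auto

lemma length_sigma: "length w \<le> length (sigma w)"
proof (induction w)
  case (Cons c w)
  then show ?case using length_sigma_letter[of c] by simp
qed simp

lemma length_sigma_pow: "length w \<le> length ((sigma ^^ k) w)"
proof (induction k)
  case (Suc k)
  then show ?case using length_sigma[of "(sigma ^^ k) w"] by simp
qed simp

lemma length_sigma_strict: "length w < length (sigma w)" if "w \<noteq> []" "hd w = A"
  using that length_sigma[of "tl w"] by (cases w) auto

lemma hd_sigma: "w \<noteq> [] \<Longrightarrow> sigma w \<noteq> [] \<and> hd (sigma w) = A"
  by (cases w; cases "hd w") auto

lemma sigma_pow_hd: "(sigma ^^ k) [A] \<noteq> [] \<and> hd ((sigma ^^ k) [A]) = A"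
  by (induction k) (use hd_sigma in auto)

lemma length_sigma_pow_A: "k < length ((sigma ^^ k) [A])"
proof (induction k)
  case (Suc k)
  then show ?case using length_sigma_strict[of "(sigma ^^ k) [A]"] sigma_pow_hd[of k] by simp
qed simp

lemma subword_0_add: "subword x 0 (m + n) = subword x 0 m @ subword x m n"
  using upt_add_eq_append[of 0 m n] by (simp add: subword_def)

lemma length_subword [simp]: "length (subword x i l) = l"
  by (simp add: subword_def)

lemma nth_subword [simp]: "j < l \<Longrightarrow> subword x i l ! j = x (i + j)"
  by (simp add: subword_def)

lemma fixed_sigma_subword:
  assumes "sigma_inf x = x"
  shows "sigma (subword x 0 n) = subword x 0 (length (sigma (subword x 0 n)))"
proof (rule nth_equalityI)
  fix i assume i: "i < length (sigma (subword x 0 n))"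
  define N where "N = n + Suc i"
  have *: "sigma (subword x 0 N) = sigma (subword x 0 n) @ sigma (subword x n (Suc i))"
    unfolding N_def subword_0_add by simp
  have "N = Suc i + n" by (simp add: N_def)
  then have **: "sigma (subword x 0 N) = sigma (subword x 0 (Suc i)) @ sigma (subword x (Suc i) n)"
    by (simp only: subword_0_add sigma_append)
  have "i < length (sigma (subword x 0 (Suc i)))"
    using length_sigma[of "subword x 0 (Suc i)"] by simp
  then have "sigma (subword x 0 N) ! i = sigma (subword x 0 (Suc i)) ! i"
    by (simp only: ** nth_append if_True)
  also have "\<dots> = x i" using fun_cong[OF assms, of i] by (simp add: sigma_inf_def)
  finally have "sigma (subword x 0 n) ! i = x i" using i by (simp add: * nth_append)
  then show "sigma (subword x 0 n) ! i = subword x 0 (length (sigma (subword x 0 n))) ! i"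
    using i by simp
qed simp

lemma fixed_sigma_pow_subword:
  assumes "sigma_inf x = x"
  shows "(sigma ^^ k) (subword x 0 n) = subword x 0 (length ((sigma ^^ k) (subword x 0 n)))"
proof (induction k)
  case (Suc k)
  define W where "W = (sigma ^^ k) (subword x 0 n)"
  obtain L where L: "W = subword x 0 L" using Suc.IH unfolding W_def by blast
  have "sigma W = subword x 0 (length (sigma W))"
    unfolding L by (rule fixed_sigma_subword[OF assms])
  then show ?case by (simp add: W_def)
qed simp

lemma fixed_eq:
  assumes "sigma_inf x = x" "x 0 = A"
  shows "x i = (sigma ^^ i) [A] ! i"
proof -
  have "[A] = subword x 0 1" using assms(2) by (simp add: subword_def)
  then have "(sigma ^^ i) [A] = subword x 0 (length ((sigma ^^ i) [A]))"
    using fixed_sigma_pow_subword[OF assms(1), of i 1] by simp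
  then show ?thesis using length_sigma_pow_A[of i] by (metis add_0 nth_subword)
qed

lemma sigma_pow_A_prefix: "\<exists>v. (sigma ^^ (k + d)) [A] = (sigma ^^ k) [A] @ v"
proof (induction d)
  case (Suc d)
  then obtain v where v: "(sigma ^^ (k + d)) [A] = (sigma ^^ k) [A] @ v" by blast
  have "(sigma ^^ Suc k) [A] = (sigma ^^ k) [A] @ (sigma ^^ k) [B]"
    using sigma_pow_append[of k "[A]" "[B]"] by (simp add: funpow_Suc_right del: funpow.simps)
  then show ?case using v by simp
qed simp

lemma sigma_pow_A_nth:
  assumes "i < length ((sigma ^^ k) [A])"
  shows "(sigma ^^ k) [A] ! i = (sigma ^^ i) [A] ! i"
proof (cases "k \<le> i")
  case True
  then obtain v where "(sigma ^^ i) [A] = (sigma ^^ k) [A] @ v"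
    using sigma_pow_A_prefix[of k "i - k"] by auto
  then show ?thesis using assms by (simp add: nth_append)
next
  case False
  then obtain v where "(sigma ^^ k) [A] = (sigma ^^ i) [A] @ v"
    using sigma_pow_A_prefix[of i "k - i"] by auto
  then show ?thesis using length_sigma_pow_A[of i] by (simp add: nth_append)
qed

lemma fixed_exists:
  defines "x \<equiv> \<lambda>i. (sigma ^^ i) [A] ! i"
  shows "sigma_inf x = x \<and> x 0 = A"
proof (intro conjI ext)
  fix i
  let ?W = "(sigma ^^ i) [A]"
  have W: "?W = subword x 0 (Suc i) @ drop (Suc i) ?W"
  proof -
    have "take (Suc i) ?W = subword x 0 (Suc i)"
      using length_sigma_pow_A[of i] sigma_pow_A_nth[of _ i]
      by (intro nth_equalityI) (auto simp: x_def)
    then show ?thesis using append_take_drop_id[of "Suc i" ?W] by simp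
  qed
  have "sigma ?W = sigma (subword x 0 (Suc i)) @ sigma (drop (Suc i) ?W)"
    using arg_cong[OF W, of sigma] by (simp only: sigma_append)
  moreover have "i < length (sigma (subword x 0 (Suc i)))"
    using length_sigma[of "subword x 0 (Suc i)"] by simp
  ultimately have "sigma (subword x 0 (Suc i)) ! i = (sigma ^^ Suc i) [A] ! i"
    by (simp add: nth_append)
  also have "\<dots> = x i"
    unfolding x_def using length_sigma_pow_A[of "Suc i"] by (intro sigma_pow_A_nth) simp
  finally show "sigma_inf x i = x i" by (simp add: sigma_inf_def)
qed (simp add: x_def)

lemma fib_word_ex1: "\<exists>!x. sigma_inf x = x \<and> x 0 = A"
proof (rule ex1I)
  show "sigma_inf (\<lambda>i. (sigma ^^ i) [A] ! i) = (\<lambda>i. (sigma ^^ i) [A] ! i)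
      \<and> (\<lambda>i. (sigma ^^ i) [A] ! i) 0 = A"
    by (rule fixed_exists)
  show "x = (\<lambda>i. (sigma ^^ i) [A] ! i)" if "sigma_inf x = x \<and> x 0 = A" for x
    using fixed_eq that by blast
qed

lemma sigma_inf_fib_word: "sigma_inf fib_word = fib_word"
  and fib_word_0: "fib_word 0 = A"
  using theI'[OF fib_word_ex1] by (simp_all add: fib_word_def)

lemma fib_word_eq: "fib_word i = (sigma ^^ i) [A] ! i"
  by (rule fixed_eq[OF sigma_inf_fib_word fib_word_0])

lemma sigma_pow_fib_word:
  "(sigma ^^ k) (subword fib_word 0 n) = subword fib_word 0 (length ((sigma ^^ k) (subword fib_word 0 n)))"
  by (rule fixed_sigma_pow_subword[OF sigma_inf_fib_word])

lemma subword_0_Suc: "subword x 0 (Suc n) = subword x 0 n @ [x n]"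
  by (simp add: subword_def)

lemma sigma_pow_occurs:
  assumes "fib_word t = A"
  shows "\<exists>s \<ge> t. subword fib_word s (length ((sigma ^^ k) [A])) = (sigma ^^ k) [A]"
proof -
  define s where "s = length ((sigma ^^ k) (subword fib_word 0 t))"
  define l where "l = length ((sigma ^^ k) [A])"
  have "(sigma ^^ k) (subword fib_word 0 t) @ (sigma ^^ k) [A] = subword fib_word 0 (s + l)"
    using sigma_pow_fib_word[of k "Suc t"] assms
    by (simp add: subword_0_Suc sigma_pow_append s_def l_def)
  then have "(sigma ^^ k) [A] = subword fib_word s l"
    unfolding subword_0_add by (simp add: s_def)
  moreover have "s \<ge> t" using length_sigma_pow[of "subword fib_word 0 t" k] by (simp add: s_def)
  ultimately show ?thesis by (auto simp: l_def)
qed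

lemma letter_A_infinitely_often: "\<exists>s \<ge> t. fib_word s = A"
proof -
  define s where "s = length (sigma (subword fib_word 0 t))"
  have "fib_word s = A"
  proof -
    have eq: "sigma (subword fib_word 0 t) @ sigma_letter (fib_word t)
        = subword fib_word 0 (s + length (sigma_letter (fib_word t)))"
      using sigma_pow_fib_word[of 1 "Suc t"] by (simp add: subword_0_Suc s_def)
    then have "sigma_letter (fib_word t) = subword fib_word s (length (sigma_letter (fib_word t)))"
      unfolding subword_0_add by (simp add: s_def)
    then have "sigma_letter (fib_word t) ! 0 = fib_word s"
      using sigma_letter_not_Nil[of "fib_word t"]
        nth_subword[of 0 "length (sigma_letter (fib_word t))" fib_word s] by simp
    then show ?thesis by (cases "fib_word t") auto
  qed
  moreover have "s \<ge> t" using length_sigma[of "subword fib_word 0 t"] by (simp add: s_def)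
  ultimately show ?thesis by blast
qed

lemma infinite_occs:
  assumes "factor w"
  shows "infinite (occs w)"
proof -
  obtain i where i: "subword fib_word i (length w) = w"
    using assms by (auto simp: factor_def occs_def)
  define k where "k = i + length w"
  have "\<exists>j \<ge> N. j \<in> occs w" for N
  proof -
    obtain t where t: "t \<ge> N" "fib_word t = A" using letter_A_infinitely_often by blast
    obtain s where s: "s \<ge> t"
      and sub: "subword fib_word s (length ((sigma ^^ k) [A])) = (sigma ^^ k) [A]"
      using sigma_pow_occurs[OF t(2)] by blast
    have "fib_word (s + j) = fib_word j" if "j < k" for j
    proof -
      have j: "j < length ((sigma ^^ k) [A])" using that length_sigma_pow_A[of k] by simp
      have "fib_word (s + j) = (sigma ^^ k) [A] ! j" using sub j by (metis nth_subword)
      also have "\<dots> = fib_word j" using sigma_pow_A_nth[OF j] by (simp add: fib_word_eq)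
      finally show ?thesis .
    qed
    then have "subword fib_word (s + i) (length w) = subword fib_word i (length w)"
      by (intro nth_equalityI) (auto simp: k_def add.assoc)
    then have "s + i \<in> occs w" using i by (simp add: occs_def)
    then show ?thesis using s t by (intro exI[of _ "s + i"]) auto
  qed
  then show ?thesis by (simp add: infinite_nat_iff_unbounded_le)
qed

lemma finite_cube_set: "finite (cube_set n)"
proof -
  have fin: "finite (UNIV :: letter set)"
  proof -
    have "(UNIV :: letter set) = {A, B}" by (auto intro: letter.exhaust)
    then show ?thesis by (rule ssubst) simp
  qed
  have "cube_set n \<subseteq> {w. set w \<subseteq> UNIV \<and> length w \<le> n} \<times> {..n}"
  proof clarify
    fix w p assume "(w, p) \<in> cube_set n"
    then have *: "infinite (occs w)" "occ_pos w (p + 2) + length w \<le> n"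
      using infinite_occs by (auto simp: cube_set_def cube_in_prefix_def)
    have "p \<le> occ_pos w (p + 2)"
      using le_enumerate[OF *(1), of "p + 1"] by (simp add: occ_pos_def)
    then show "w \<in> {w. set w \<subseteq> UNIV \<and> length w \<le> n} \<and> p \<in> {..n}" using *(2) by auto
  qed
  then show ?thesis
    by (rule finite_subset) (intro finite_cartesian_product finite_lists_length_le fin finite_atMost)
qed

end

theory Submission
  imports Defs
begin

text \<open>Write \<open>x\<close> for the Fibonacci word, positions counted from 0.

A cube occurrence is the same as a pair \<open>(q, l)\<close> such that \<open>x\<close> has period \<open>l\<close> on an interval of
length \<open>3 * l\<close> starting at \<open>q\<close>. The one thing to check is that the three copies of the root are
consecutive occurrences: an occurrence strictly between two adjacent copies would make the
root a proper power.
This, and the list of possible periods, comes from desubstitution (\<open>near_square_period\<close>): a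
repetition of period \<open>l \<ge> 2\<close> is, up to a shift by one, the image under \<open>sigma\<close> of a repetition
of smaller period. A square loses its last letter in the process, so the invariant is carried
by intervals of length \<open>2 * l - 1\<close> with period \<open>l\<close>; going back up, the pair (number of letters
\<open>A\<close> in the root, length of the root) runs through consecutive Fibonacci numbers. These are
coprime, so roots are primitive, and the period of a cube is a Fibonacci number.

For the period \<open>fib (k + 2)\<close>, the length of \<open>sigma\<^sup>k(A)\<close>, cut \<open>x\<close> into the blocks
\<open>sigma\<^sup>k\<^sup>+\<^sup>1(x i)\<close>. As \<open>sigma\<^sup>k(AB)\<close> and \<open>sigma\<^sup>k(BA)\<close> differ exactly in their last two letters, \<open>x\<close>
and its shift by \<open>fib (k + 2)\<close> disagree exactly at the last two positions of each block with
\<open>x i = A\<close> (\<open>match_in_block\<close>). Only across a block with \<open>x i = B\<close> is there enough room between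
two disagreements for a cube, and it has \<open>fib (k + 1) - 1\<close> starting points there
(\<open>cube_at_fib_iff\<close>). In the prefix of length \<open>fib (m + 2)\<close>, which consists of the first
\<open>fib (m - k + 1)\<close> blocks, such a cube fits if and only if the two blocks after the \<open>i\<close>-th do
(\<open>cube_fits_iff\<close>), and \<open>fib (m - 1 - k) - 1\<close> letters \<open>B\<close> satisfy this. Hence
\<open>D (fib (m + 2))\<close> is the sum over \<open>k < m\<close> of \<open>(fib (k + 1) - 1) * (fib (m - 1 - k) - 1)\<close>
(\<open>D_fib\<close>). The closed form follows from the convolution of the Fibonacci sequence with itself.\<close>

section \<open>Block decompositions of the Fibonacci word\<close>

text \<open>As the Fibonacci word is fixed by \<open>sigma\<close>, it is the concatenation of the blocks
\<open>(sigma ^^ k) [fib_word j]\<close> for \<open>j = 0, 1, \<dots>\<close>; this is where the \<open>j\<close>-th of them starts.\<close>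

definition bpos :: "nat \<Rightarrow> nat \<Rightarrow> nat" where
  "bpos k j = length ((sigma ^^ k) (subword fib_word 0 j))"

abbreviation spos :: "nat \<Rightarrow> nat" where
  "spos \<equiv> bpos (Suc 0)"

lemma sigma_pow_Nil [simp]: "(sigma ^^ k) [] = []"
  by (induction k) auto

lemma bpos_0 [simp]: "bpos k 0 = 0"
  by (simp add: bpos_def subword_def)

lemma bpos_add: "bpos k (j + n) = bpos k j + length ((sigma ^^ k) (subword fib_word j n))"
  by (simp add: bpos_def subword_0_add sigma_pow_append)

lemma bpos_Suc: "bpos k (Suc j) = bpos k j + length ((sigma ^^ k) [fib_word j])"
  using bpos_add[of k j 1] by (simp add: subword_def)

lemma length_sigma_pow_letters:
  "length ((sigma ^^ k) [A]) = fib (k + 2)" "length ((sigma ^^ k) [B]) = fib (k + 1)"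
proof (induction k)
  case (Suc k)
  have "(sigma ^^ Suc k) [A] = (sigma ^^ k) [A] @ (sigma ^^ k) [B]"
       "(sigma ^^ Suc k) [B] = (sigma ^^ k) [A]"
    using sigma_pow_append[of k "[A]" "[B]"] by (simp_all add: funpow_Suc_right del: funpow.simps)
  { case 1 show ?case using Suc \<open>(sigma ^^ Suc k) [A] = _\<close> by simp }
  { case 2 show ?case using Suc \<open>(sigma ^^ Suc k) [B] = _\<close> by simp }
qed simp_all

lemma length_sigma_pow_pos: "0 < length ((sigma ^^ k) [c])"
  using length_sigma_pow[of "[c]" k] by (simp del: length_greater_0_conv)

lemma strict_mono_bpos: "strict_mono (bpos k)"
  unfolding strict_mono_Suc_iff bpos_Suc using length_sigma_pow_pos by (simp del: length_greater_0_conv)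

lemma subword_bpos:
  "subword fib_word (bpos k j) (length ((sigma ^^ k) (subword fib_word j n))) =
     (sigma ^^ k) (subword fib_word j n)"
proof -
  have "subword fib_word 0 (bpos k (j + n)) = (sigma ^^ k) (subword fib_word 0 (j + n))"
    unfolding bpos_def by (rule sigma_pow_fib_word[symmetric])
  moreover have "subword fib_word 0 (bpos k j) = (sigma ^^ k) (subword fib_word 0 j)"
    unfolding bpos_def by (rule sigma_pow_fib_word[symmetric])
  ultimately show ?thesis
    by (simp add: bpos_add subword_0_add sigma_pow_append)
qed

lemma fib_word_bpos:
  assumes "t < length ((sigma ^^ k) (subword fib_word j n))"
  shows "fib_word (bpos k j + t) = (sigma ^^ k) (subword fib_word j n) ! t"
  using arg_cong[OF subword_bpos[of k j n], of "\<lambda>w. w ! t"] assms by simp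

lemma bpos_cover: "\<exists>j t. q = bpos k j + t \<and> t < length ((sigma ^^ k) [fib_word j])"
proof (induction q)
  case 0
  show ?case by (rule exI[of _ 0], rule exI[of _ 0]) (use length_sigma_pow_pos in simp)
next
  case (Suc q)
  then obtain j t where jt: "q = bpos k j + t" "t < length ((sigma ^^ k) [fib_word j])"
    by blast
  show ?case
  proof (cases "Suc t < length ((sigma ^^ k) [fib_word j])")
    case True
    then show ?thesis using jt by (intro exI[of _ j] exI[of _ "Suc t"]) simp
  next
    case False
    then have "Suc q = bpos k (Suc j)" using jt by (simp add: bpos_Suc)
    then show ?thesis
      using length_sigma_pow_pos by (intro exI[of _ "Suc j"] exI[of _ 0]) simp
  qed
qed

lemma bpos_unique:
  assumes "bpos k i + t = bpos k j + u"
    and "t < length ((sigma ^^ k) [fib_word i])" "u < length ((sigma ^^ k) [fib_word j])"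
  shows "i = j"
proof -
  have *: "\<not> i' < j'" if "bpos k i' + t' = bpos k j' + u'"
    "t' < length ((sigma ^^ k) [fib_word i'])" for i' j' t' u'
  proof
    assume "i' < j'"
    then have "bpos k (Suc i') \<le> bpos k j'"
      using strict_mono_bpos by (simp add: strict_mono_less_eq)
    then show False using that by (simp add: bpos_Suc)
  qed
  show ?thesis using *[OF assms(1,2)] *[OF assms(1)[symmetric] assms(3)] by simp
qed

lemma spos_Suc: "spos (Suc j) = spos j + (if fib_word j = A then 2 else 1)"
  by (cases "fib_word j") (simp_all add: bpos_Suc)

lemma fib_word_spos: "fib_word (spos j) = A"
proof -
  have "fib_word (spos j + 0) = (sigma ^^ Suc 0) (subword fib_word j 1) ! 0"
    by (rule fib_word_bpos) (simp add: subword_def sigma_letter_not_Nil)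
  then show ?thesis by (cases "fib_word j") (simp_all add: subword_def)
qed

lemma fib_word_spos_Suc: "fib_word (Suc (spos j)) = B \<longleftrightarrow> fib_word j = A"
proof (cases "fib_word j")
  case A
  then have "fib_word (spos j + 1) = (sigma ^^ Suc 0) (subword fib_word j 1) ! 1"
    by (intro fib_word_bpos) (simp add: subword_def)
  then show ?thesis using A by (simp add: subword_def)
next
  case B
  then show ?thesis using fib_word_spos[of "Suc j"] by (simp add: spos_Suc)
qed

text \<open>Every \<open>sigma\<close>-block starts with its only \<open>A\<close>, so the letters \<open>A\<close> mark the cutting points.
This is what makes desubstitution possible.\<close>

lemma fib_word_A_iff: "fib_word q = A \<longleftrightarrow> (\<exists>j. q = spos j)"
proof
  assume q: "fib_word q = A"
  obtain j t where jt: "q = spos j + t" "t < length ((sigma ^^ Suc 0) [fib_word j])"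
    using bpos_cover by blast
  have "t = 0"
  proof (rule ccontr)
    assume "t \<noteq> 0"
    then have "t = 1 \<and> fib_word j = A" using jt(2) by (cases "fib_word j") auto
    then show False using q jt(1) fib_word_spos_Suc[of j] by simp
  qed
  then show "\<exists>j. q = spos j" using jt by auto
qed (auto simp: fib_word_spos)

lemma fib_word_no_BB: "fib_word j = B \<Longrightarrow> fib_word (Suc j) = A"
proof -
  assume q: "fib_word j = B"
  obtain i t where it: "j = spos i + t" "t < length ((sigma ^^ Suc 0) [fib_word i])"
    using bpos_cover by blast
  have "t \<noteq> 0" using q it fib_word_spos[of i] by (auto intro: ccontr)
  then have "t = 1 \<and> fib_word i = A" using it(2) by (cases "fib_word i") auto
  then have "Suc j = spos (Suc i)" using it by (simp add: spos_Suc)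
  then show ?thesis using fib_word_spos by simp
qed

lemma length_sigma_count: "length (sigma w) = length w + count_list w A"
proof (induction w)
  case (Cons c w) then show ?case by (cases c) auto
qed simp

lemma count_A_sigma: "count_list (sigma w) A = length w"
proof (induction w)
  case (Cons c w) then show ?case by (cases c) auto
qed simp

section \<open>Desubstitution: roots of repetitions have Fibonacci length\<close>

lemma subword_Suc_left: "subword x i (Suc l) = x i # subword x (Suc i) l"
  by (simp add: subword_def upt_rec)

lemma subword_Suc_right: "subword x i (Suc l) = subword x i l @ [x (i + l)]"
  by (simp add: subword_def)

text \<open>By strong induction on \<open>l\<close>. Suppose the interval starts with \<open>A\<close>. Then \<open>i\<close> and \<open>i + l\<close> are
cutting points \<open>spos a\<close> and \<open>spos b\<close>, so the root is \<open>sigma w\<close> with \<open>w\<close> of length \<open>b - a < l\<close>,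
and reading the \<open>sigma\<close>-blocks from left to right shows that the repetition descends to one of
period \<open>b - a\<close> at \<open>a\<close>. The last letter of the second copy of \<open>w\<close> may be lost: its block is
only known to start with \<open>A\<close>. This is why the hypothesis asks for \<open>l - 1\<close> agreements instead
of the \<open>l\<close> of a square. If the interval starts with \<open>B\<close>, both copies of the root are preceded by
\<open>A\<close>, and the interval can be moved one step to the left, which conjugates the root.
The count of \<open>A\<close> is part of the claim because the length of \<open>sigma w\<close> depends on it.\<close>

lemma near_square_period:
  assumes "0 < l" and "\<And>j. j < l - 1 \<Longrightarrow> fib_word (i + j) = fib_word (i + j + l)"
  shows "\<exists>k. l = fib (k + 1) \<and> count_list (subword fib_word i l) A = fib k"
  using assms
proof (induction l arbitrary: i rule: less_induct)
  case (less l)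
  have at_A: "\<exists>k. l = fib (k + 1) \<and> count_list (subword fib_word i l) A = fib k"
    if l: "2 \<le> l" and iA: "fib_word i = A"
      and per: "\<And>j. j < l - 1 \<Longrightarrow> fib_word (i + j) = fib_word (i + j + l)" for i
  proof -
    have "fib_word (i + l) = A" using per[of 0] l iA by simp
    then obtain a b where a: "i = spos a" and b: "i + l = spos b"
      using iA by (auto simp: fib_word_A_iff)
    have "a < b" using a b l strict_mono_less[OF strict_mono_bpos, of "Suc 0" a b] by simp
    define l' where "l' = b - a"
    have l': "0 < l'" "b = a + l'" using \<open>a < b\<close> by (simp_all add: l'_def)
    let ?w = "subword fib_word a l'"
    have sw: "l = length (sigma ?w)" using bpos_add[of "Suc 0" a l'] a b l' by simp
    have image: "subword fib_word i l = sigma ?w"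
      using subword_bpos[of "Suc 0" a l'] by (simp add: a sw)
    have len: "l = l' + count_list ?w A" using sw by (simp add: length_sigma_count)
    have "l' < l"
    proof (cases "l' = 1")
      case False
      then obtain l'' where "l' = Suc (Suc l'')" using l' by (metis One_nat_def not0_implies_Suc less_numeral_extra(3))
      then have "count_list ?w A \<noteq> 0"
        using fib_word_no_BB[of a] by (cases "fib_word a") (auto simp: subword_Suc_left)
      then show ?thesis using len by linarith
    qed (use l in simp)
    \<comment> \<open>If the blocks of \<open>a + j\<close> and \<open>b + j\<close> start at distance \<open>l\<close>, comparing their second letters
      tells whether both are \<open>AB\<close> or both are \<open>A\<close>. For this the second letter must lie in the
      range of agreement; it could miss it only if \<open>a + j\<close> and \<open>b - 1\<close> were adjacent and both \<open>B\<close>.\<close>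
    have step: "fib_word (a + j) = fib_word (b + j)"
      if "spos (b + j) = spos (a + j) + l" "j < l' - 1" for j
    proof -
      have le: "spos (Suc (a + j)) \<le> spos (b - 1)"
        using that l' strict_mono_bpos by (simp add: strict_mono_less_eq)
      have b1: "spos b = spos (b - 1) + (if fib_word (b - 1) = A then 2 else 1)"
        using spos_Suc[of "b - 1"] l' by simp
      have lt: "spos (a + j) + 1 < i + l - 1"
      proof (cases "Suc (a + j) = b - 1")
        case True
        then have "fib_word (a + j) = A \<or> fib_word (b - 1) = A"
          using fib_word_no_BB[of "a + j"] by (cases "fib_word (a + j)") auto
        then show ?thesis using True b1 b spos_Suc[of "a + j"] by (auto split: if_splits)
      next
        case False
        then have "spos (Suc (a + j)) < spos (b - 1)"
          using that l' strict_mono_bpos by (simp add: strict_mono_less)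
        then show ?thesis using b1 b spos_Suc[of "a + j"] by (auto split: if_splits)
      qed
      have "i \<le> spos (a + j)" using a strict_mono_bpos by (simp add: strict_mono_less_eq)
      then have "fib_word (spos (a + j) + 1) = fib_word (spos (a + j) + 1 + l)"
        using per[of "spos (a + j) + 1 - i"] lt by simp
      then have "fib_word (Suc (spos (a + j))) = B \<longleftrightarrow> fib_word (Suc (spos (b + j))) = B"
        using that by simp
      then have "fib_word (a + j) = A \<longleftrightarrow> fib_word (b + j) = A"
        by (simp only: fib_word_spos_Suc)
      then show ?thesis by (metis letter.exhaust)
    qed
    have sync: "spos (b + j) = spos (a + j) + l" if "j \<le> l' - 1" for j
      using that
    proof (induction j)
      case 0 then show ?case using a b by simp
    next
      case (Suc j)
      then show ?case using step[of j] spos_Suc[of "a + j"] spos_Suc[of "b + j"] by simp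
    qed
    have "fib_word (a + j) = fib_word (a + j + l')" if "j < l' - 1" for j
      using step[OF sync that] that l' by (simp add: ac_simps)
    then obtain k where k: "l' = fib (k + 1)" "count_list ?w A = fib k"
      using less.IH[OF \<open>l' < l\<close> l'(1)] by blast
    then show ?thesis
      using len image by (intro exI[of _ "Suc k"]) (simp add: count_A_sigma)
  qed
  show ?case
  proof (cases "l = 1")
    case True
    have "subword fib_word i 1 = [fib_word i]" by (simp add: subword_def)
    then show ?thesis
      using True by (cases "fib_word i") (auto intro: exI[of _ 0] exI[of _ 1])
  next
    case False
    then have l: "2 \<le> l" using less.prems by simp
    show ?thesis
    proof (cases "fib_word i")
      case A
      then show ?thesis using at_A[OF l] less.prems by blast
    next
      case B
      have "i \<noteq> 0" using B fib_word_0 by (auto intro: ccontr)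
      then obtain i' where i': "i = Suc i'" by (cases i) auto
      have "fib_word (i + l) = B" using less.prems(2)[of 0] B l by simp
      then have ends: "fib_word i' = A" "fib_word (i' + l) = A"
        using fib_word_no_BB[of i'] fib_word_no_BB[of "i' + l"] B i'
        by (metis add_Suc letter.distinct(1) letter.exhaust)+
      have "fib_word (i' + j) = fib_word (i' + j + l)" if "j < l - 1" for j
        using less.prems(2)[of "j - 1"] ends that i' by (cases j) auto
      then obtain k where k: "l = fib (k + 1)" "count_list (subword fib_word i' l) A = fib k"
        using at_A[OF l ends(1)] by blast
      have "count_list (subword fib_word i' (Suc l)) A = 1 + count_list (subword fib_word i l) A"
        using ends i' by (simp add: subword_Suc_left)
      moreover have "count_list (subword fib_word i' (Suc l)) A = count_list (subword fib_word i' l) A + 1"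
        using ends by (simp add: subword_Suc_right)
      ultimately show ?thesis using k by auto
    qed
  qed
qed

lemma count_list_concat_replicate:
  "count_list (concat (replicate n z)) c = n * count_list z c"
  by (induction n) auto

lemma length_concat_replicate: "length (concat (replicate n z)) = n * length z"
  by (induction n) auto

lemma subword_add: "subword x i (m + n) = subword x i m @ subword x (i + m) n"
  using upt_add_eq_append[of i "i + m" n] by (simp add: subword_def add.assoc)

text \<open>An inner occurrence at distance \<open>d\<close> splits the root as \<open>u @ v = v @ u\<close>, so the root is a power
of some \<open>z\<close> with exponent at least 2. This exponent would divide both the length of the root and
its number of letters \<open>A\<close>, which are consecutive Fibonacci numbers and hence coprime.\<close>

lemma square_no_inner_occurrence:
  assumes sq: "subword fib_word (q + l) l = subword fib_word q l"
    and d: "0 < d" "d < l"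
  shows "subword fib_word (q + d) l \<noteq> subword fib_word q l"
proof
  assume inner: "subword fib_word (q + d) l = subword fib_word q l"
  define u where "u = subword fib_word q d"
  define v where "v = subword fib_word (q + d) (l - d)"
  have w: "subword fib_word q l = u @ v"
    using subword_add[of fib_word q d "l - d"] d by (simp add: u_def v_def)
  have "subword fib_word (q + l) d = take d (subword fib_word (q + l) l)"
    using subword_add[of fib_word "q + l" d "l - d"] d by simp
  also have "\<dots> = u" by (simp add: sq w u_def)
  finally have "subword fib_word (q + d) l = v @ u"
    using subword_add[of fib_word "q + d" "l - d" d] d by (simp add: v_def)
  then have comm: "u @ v = v @ u" using inner w by simp
  obtain m n z where z: "concat (replicate m z) = u" "concat (replicate n z) = v"
    using comm_append_are_replicate[OF comm] by blast
  have "u \<noteq> []" "v \<noteq> []" using d by (auto simp: u_def v_def simp flip: length_0_conv)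
  then have "m \<noteq> 0" "n \<noteq> 0" using z by (auto intro: ccontr)
  have "fib_word (q + j) = fib_word (q + j + l)" if "j < l - 1" for j
    using arg_cong[OF sq, of "\<lambda>w. w ! j"] that by (simp add: ac_simps)
  then obtain k where k: "l = fib (k + 1)" "count_list (u @ v) A = fib k"
    using near_square_period[of l q] d w by auto
  have "l = length (u @ v)" using w by (metis length_subword)
  then have "l = (m + n) * length z"
    by (simp add: algebra_simps length_concat_replicate flip: z)
  moreover have "fib k = (m + n) * count_list z A"
    using k by (simp add: algebra_simps count_list_concat_replicate flip: z)
  ultimately have "m + n dvd fib (k + 1)" "m + n dvd fib k" using k(1) by simp_all
  then have "m + n dvd 1"
    using coprime_common_divisor[OF coprime_fib_Suc_nat[of k], of "m + n"] by simp
  then have "m + n = 1" by simp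
  then show False using \<open>m \<noteq> 0\<close> \<open>n \<noteq> 0\<close> by simp
qed

section \<open>Cubes as positions and periods\<close>

definition cube_at :: "nat \<Rightarrow> nat \<Rightarrow> bool" where
  "cube_at q l \<longleftrightarrow> 0 < l \<and> (\<forall>j. q \<le> j \<and> j < q + 2 * l \<longrightarrow> fib_word j = fib_word (j + l))"

lemma subword_eq_shift_iff:
  "subword x (q + l) n = subword x q n \<longleftrightarrow> (\<forall>j. q \<le> j \<and> j < q + n \<longrightarrow> x j = x (j + l))"
proof -
  have "subword x (q + l) n = subword x q n \<longleftrightarrow> (\<forall>t<n. x (q + l + t) = x (q + t))"
    by (auto simp: list_eq_iff_nth_eq)
  also have "\<dots> \<longleftrightarrow> (\<forall>j. q \<le> j \<and> j < q + n \<longrightarrow> x j = x (j + l))"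
  proof (intro iffI allI impI)
    fix j assume "\<forall>t<n. x (q + l + t) = x (q + t)" "q \<le> j \<and> j < q + n"
    then show "x j = x (j + l)" by (auto dest!: spec[of _ "j - q"] simp: add.commute)
  next
    fix t assume "\<forall>j. q \<le> j \<and> j < q + n \<longrightarrow> x j = x (j + l)" "t < n"
    then show "x (q + l + t) = x (q + t)" by (auto dest!: spec[of _ "q + t"] simp: ac_simps)
  qed
  finally show ?thesis .
qed

lemma cube_at_iff_subwords:
  "cube_at q l \<longleftrightarrow> 0 < l \<and> subword fib_word (q + l) l = subword fib_word q l
     \<and> subword fib_word (q + 2 * l) l = subword fib_word q l"
proof -
  have "cube_at q l \<longleftrightarrow> 0 < l \<and> subword fib_word (q + l) (l + l) = subword fib_word q (l + l)"
    by (simp add: cube_at_def subword_eq_shift_iff mult_2)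
  also have "\<dots> \<longleftrightarrow> 0 < l \<and> subword fib_word (q + l) l = subword fib_word q l
     \<and> subword fib_word (q + 2 * l) l = subword fib_word (q + l) l"
    by (simp only: subword_add) (simp add: mult_2 add.assoc)
  finally show ?thesis by auto
qed

lemma enumerate_Suc_eq:
  fixes S :: "nat set"
  assumes "infinite S" "b \<in> S" "enumerate S n < b"
    and "\<And>c. enumerate S n < c \<Longrightarrow> c < b \<Longrightarrow> c \<notin> S"
  shows "enumerate S (Suc n) = b"
  unfolding enumerate_Suc''[OF assms(1)]
  using assms(2-4) by (intro Least_equality) (auto intro: leI)

lemma subword_occ_pos: "factor w \<Longrightarrow> subword fib_word (occ_pos w p) (length w) = w"
  using enumerate_in_set[OF infinite_occs, of w "p - 1"] by (simp add: occs_def occ_pos_def)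

text \<open>Adjacent copies of a factor are automatically consecutive occurrences, since
\<open>square_no_inner_occurrence\<close> excludes anything in between. So the condition on the \<open>p\<close>-th to
\<open>(p + 2)\<close>-nd occurrences reduces to a periodicity of the word.\<close>

lemma cube_in_prefix_iff:
  assumes "w \<noteq> []" "factor w" "1 \<le> p"
  shows "cube_in_prefix w p n \<longleftrightarrow>
    cube_at (occ_pos w p) (length w) \<and> occ_pos w p + 3 * length w \<le> n"
proof -
  let ?l = "length w"
  have inf: "infinite (occs w)" using infinite_occs assms by blast
  have w: "subword fib_word (occ_pos w r) ?l = w" for r
    using subword_occ_pos assms by blast
  have next_occ: "occ_pos w (r + 1) = occ_pos w r + ?l"
    if "subword fib_word (occ_pos w r + ?l) ?l = w" "1 \<le> r" for r
  proof -
    have "enumerate (occs w) (Suc (r - 1)) = occ_pos w r + ?l"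
    proof (rule enumerate_Suc_eq[OF inf])
      show "occ_pos w r + ?l \<in> occs w" using that by (simp add: occs_def)
      show "enumerate (occs w) (r - 1) < occ_pos w r + ?l"
        using assms by (simp add: occ_pos_def)
      fix c assume c: "enumerate (occs w) (r - 1) < c" "c < occ_pos w r + ?l"
      then have "subword fib_word (occ_pos w r + (c - occ_pos w r)) ?l \<noteq> subword fib_word (occ_pos w r) ?l"
        using that w by (intro square_no_inner_occurrence) (auto simp: occ_pos_def)
      then show "c \<notin> occs w" using c w by (auto simp: occs_def occ_pos_def)
    qed
    then show ?thesis using that by (simp add: occ_pos_def)
  qed
  show ?thesis
  proof
    assume *: "cube_in_prefix w p n"
    then show "cube_at (occ_pos w p) ?l \<and> occ_pos w p + 3 * ?l \<le> n"
      using w[of p] w[of "p + 1"] w[of "p + 2"] assms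
      by (auto simp: cube_in_prefix_def cube_at_iff_subwords mult_2 add.assoc)
  next
    assume *: "cube_at (occ_pos w p) ?l \<and> occ_pos w p + 3 * ?l \<le> n"
    then have sub: "subword fib_word (occ_pos w p + ?l) ?l = w"
      "subword fib_word (occ_pos w p + 2 * ?l) ?l = w"
      using w[of p] by (simp_all add: cube_at_iff_subwords)
    have 1: "occ_pos w (p + 1) = occ_pos w p + ?l" using next_occ[OF sub(1)] assms by simp
    have "occ_pos w (p + 1 + 1) = occ_pos w (p + 1) + ?l"
      by (rule next_occ) (use 1 sub(2) in \<open>simp_all add: mult_2 add.assoc\<close>)
    then show "cube_in_prefix w p n" using 1 * by (simp add: cube_in_prefix_def)
  qed
qed

lemma D_eq_card_cube_at: "D n = card {(q, l). cube_at q l \<and> q + 3 * l \<le> n}"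
proof -
  let ?h = "\<lambda>(w, p). (occ_pos w p, length w)"
  have "bij_betw ?h (cube_set n) {(q, l). cube_at q l \<and> q + 3 * l \<le> n}"
  proof (rule bij_betwI')
    fix a b assume ab: "a \<in> cube_set n" "b \<in> cube_set n"
    obtain w p v r where [simp]: "a = (w, p)" "b = (v, r)" by (cases a, cases b) auto
    have fac: "factor w" "factor v" and pr: "1 \<le> p" "1 \<le> r"
      using ab by (simp_all add: cube_set_def)
    have sub: "subword fib_word (occ_pos w p) (length w) = w"
      "subword fib_word (occ_pos v r) (length v) = v"
      using subword_occ_pos fac by blast+
    show "(?h a = ?h b) = (a = b)"
    proof
      assume eq: "?h a = ?h b"
      then have same: "occ_pos w p = occ_pos v r" "length w = length v" by simp_all
      have "w = v" using sub(1) unfolding same sub(2) by (rule sym)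
      moreover have "p - 1 = r - 1"
        using same(1) strict_mono_eq[OF strict_mono_enumerate[OF infinite_occs[OF fac(1)]]]
        unfolding \<open>w = v\<close> occ_pos_def by blast
      ultimately show "a = b" using pr by simp
    qed simp
  next
    fix a assume "a \<in> cube_set n"
    then show "?h a \<in> {(q, l). cube_at q l \<and> q + 3 * l \<le> n}"
      using cube_in_prefix_iff by (auto simp: cube_set_def)
  next
    fix c assume "c \<in> {(q, l). cube_at q l \<and> q + 3 * l \<le> n}"
    then obtain q l where c: "c = (q, l)" "cube_at q l" "q + 3 * l \<le> n" by auto
    define w where "w = subword fib_word q l"
    have l: "0 < l" "length w = l" using c by (simp_all add: cube_at_def w_def)
    have q: "q \<in> occs w" by (simp add: occs_def w_def)
    then have fac: "factor w" by (auto simp: factor_def)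
    obtain r where r: "enumerate (occs w) r = q"
      using enumerate_Ex[OF infinite_occs[OF fac] q] by blast
    have "(w, Suc r) \<in> cube_set n" "?h (w, Suc r) = c"
      using cube_in_prefix_iff[of w "Suc r" n] fac l c r
      by (auto simp: cube_set_def occ_pos_def)
    then show "\<exists>a\<in>cube_set n. c = ?h a" by metis
  qed
  then show ?thesis unfolding D_def by (rule bij_betw_same_card)
qed

section \<open>Cubes of a Fibonacci period\<close>

text \<open>The induction works because \<open>sigma\<close> maps \<open>AB\<close> and \<open>BA\<close> to \<open>ABA\<close> and \<open>AAB\<close>, which again
share everything but the last two letters, now interchanged.\<close>

lemma sigma_pow_AB_BA:
  "\<exists>u c d. (sigma ^^ k) [A, B] = u @ [c, d] \<and> (sigma ^^ k) [B, A] = u @ [d, c] \<and> c \<noteq> d"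
proof (induction k)
  case 0
  then show ?case by simp
next
  case (Suc k)
  then obtain u c d where ih: "(sigma ^^ k) [A, B] = u @ [c, d]"
    "(sigma ^^ k) [B, A] = u @ [d, c]" "c \<noteq> d" by blast
  then show ?case
    by (cases c; cases d) (auto intro!: exI[of _ "sigma u @ [A]"])
qed

lemma sigma_pow_Suc_Cons:
  "(sigma ^^ Suc k) (A # w) = (sigma ^^ k) [A] @ (sigma ^^ k) [B] @ (sigma ^^ Suc k) w"
  "(sigma ^^ Suc k) (B # w) = (sigma ^^ k) [A] @ (sigma ^^ Suc k) w"
proof -
  have cons: "(sigma ^^ Suc k) (c # w) = (sigma ^^ k) (sigma_letter c) @ (sigma ^^ Suc k) w" for c
    unfolding funpow_Suc_right comp_def sigma_Cons by (rule sigma_pow_append)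
  have AB: "(sigma ^^ k) [A, B] = (sigma ^^ k) [A] @ (sigma ^^ k) [B]"
    using sigma_pow_append[of k "[A]" "[B]"] by simp
  show "(sigma ^^ Suc k) (A # w) = (sigma ^^ k) [A] @ (sigma ^^ k) [B] @ (sigma ^^ Suc k) w"
    "(sigma ^^ Suc k) (B # w) = (sigma ^^ k) [A] @ (sigma ^^ Suc k) w"
    unfolding cons sigma_letter.simps AB append_assoc by (rule refl)+
qed

text \<open>A block for \<open>B\<close> is \<open>sigma\<^sup>k(A)\<close> and the next block starts with \<open>sigma\<^sup>k(A)\<close> too, so all its
positions agree with their shift by \<open>fib (k + 2)\<close>. A block for \<open>A\<close> is \<open>sigma\<^sup>k(AB)\<close>, followed by
\<open>sigma\<^sup>k(A)\<close>; its shift reads \<open>sigma\<^sup>k(BA)\<close>, and only the last two positions disagree.\<close>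

lemma match_in_block:
  shows "fib_word i = B \<Longrightarrow> t < fib (k + 2) \<Longrightarrow>
      fib_word (bpos (Suc k) i + t) = fib_word (bpos (Suc k) i + t + fib (k + 2))"
    and "fib_word i = A \<Longrightarrow> t < fib (k + 3) \<Longrightarrow>
      fib_word (bpos (Suc k) i + t) = fib_word (bpos (Suc k) i + t + fib (k + 2))
        \<longleftrightarrow> t + 2 < fib (k + 3)"
proof -
  obtain v where v: "(sigma ^^ Suc k) [fib_word (Suc i)] = (sigma ^^ k) [A] @ v"
    using sigma_pow_Suc_Cons[of k "[]"] by (cases "fib_word (Suc i)") auto
  have pair: "subword fib_word i 2 = [fib_word i, fib_word (Suc i)]"
    by (simp add: subword_def numeral_2_eq_2)
  define W where "W = (sigma ^^ Suc k) (subword fib_word i 2)"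
  have W: "fib_word (bpos (Suc k) i + s) = W ! s" if "s < length W" for s
    using fib_word_bpos that unfolding W_def by blast
  note len = length_sigma_pow_letters
  {
    assume "fib_word i = B" "t < fib (k + 2)"
    then have "W = (sigma ^^ k) [A] @ (sigma ^^ k) [A] @ v"
      using v sigma_pow_Suc_Cons(2)[of k "[fib_word (Suc i)]"] by (simp add: W_def pair)
    then show "fib_word (bpos (Suc k) i + t) = fib_word (bpos (Suc k) i + t + fib (k + 2))"
      using W[of t] W[of "t + fib (k + 2)"] \<open>t < _\<close> len[of k]
      by (simp add: nth_append add.assoc)
  }
  {
    assume "fib_word i = A" and t: "t < fib (k + 3)"
    obtain u c d where u: "(sigma ^^ k) [A, B] = u @ [c, d]" "(sigma ^^ k) [B, A] = u @ [d, c]"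
      "c \<noteq> d" using sigma_pow_AB_BA by blast
    have AB: "(sigma ^^ k) [A] @ (sigma ^^ k) [B] = u @ [c, d]"
      and BA: "(sigma ^^ k) [B] @ (sigma ^^ k) [A] = u @ [d, c]"
      using u sigma_pow_append[of k "[A]" "[B]"] sigma_pow_append[of k "[B]" "[A]"] by simp_all
    have W_eq: "W = (sigma ^^ k) [A] @ (sigma ^^ k) [B] @ (sigma ^^ k) [A] @ v"
      using v sigma_pow_Suc_Cons(1)[of k "[fib_word (Suc i)]"] \<open>fib_word i = A\<close>
      by (simp add: W_def pair)
    have lu: "length u + 2 = fib (k + 3)"
      using arg_cong[OF AB, of length] len[of k] by (simp add: numeral_3_eq_3)
    have W_AB: "W = (u @ [c, d]) @ (sigma ^^ k) [A] @ v" using W_eq AB by (metis append.assoc)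
    have "W ! t = (u @ [c, d]) ! t"
      unfolding W_AB by (rule nth_append_left) (use t lu in simp)
    moreover have "t < length W" using W_AB t lu by simp
    ultimately have 1: "fib_word (bpos (Suc k) i + t) = (u @ [c, d]) ! t"
      using W by simp
    have W_BA: "W = (sigma ^^ k) [A] @ (u @ [d, c]) @ v" using W_eq BA by (metis append.assoc)
    have "W ! (t + fib (k + 2)) = ((u @ [d, c]) @ v) ! t"
      unfolding W_BA using len(1)[of k] by (metis add.commute nth_append_length_plus)
    also have "\<dots> = (u @ [d, c]) ! t"
      by (rule nth_append_left) (use t lu in simp)
    finally have "W ! (t + fib (k + 2)) = (u @ [d, c]) ! t" .
    moreover have "t + fib (k + 2) < length W" using W_BA t lu len(1)[of k] by simp
    ultimately have 2: "fib_word (bpos (Suc k) i + t + fib (k + 2)) = (u @ [d, c]) ! t"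
      using W by (metis add.assoc)
    consider "t < length u" | "t = length u" | "t = Suc (length u)" using lu t by linarith
    then show "fib_word (bpos (Suc k) i + t) = fib_word (bpos (Suc k) i + t + fib (k + 2))
        \<longleftrightarrow> t + 2 < fib (k + 3)"
      by cases (use 1 2 lu u(3) in \<open>auto simp: nth_append\<close>)
  }
qed

text \<open>A block for \<open>A\<close> ends with a disagreement, and it is no longer than the \<open>2 * fib (k + 2)\<close> positions
at which a cube needs agreement. So a cube starts in a block for \<open>B\<close>, of length \<open>fib (k + 2)\<close>.
The next block is one for \<open>A\<close>, so the next disagreement is at offset
\<open>fib (k + 2) + fib (k + 3) - 2\<close>; the cube avoids it exactly when its own offset \<open>t\<close>
satisfies \<open>t + 2 \<le> fib (k + 1)\<close>.\<close>

lemma cube_at_fib_iff: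
  "cube_at q (fib (k + 2)) \<longleftrightarrow>
    (\<exists>i t. q = bpos (Suc k) i + t \<and> fib_word i = B \<and> t + 2 \<le> fib (k + 1))"
proof
  have fibs: "fib (k + 3) = fib (k + 2) + fib (k + 1)" "fib (k + 2) = fib (k + 1) + fib k"
    "0 < fib (k + 1)"
    by (simp_all add: numeral_3_eq_3 fib_neq_0_nat)
  have next_block: "bpos (Suc k) (Suc i) = bpos (Suc k) i + fib (k + 2)" if "fib_word i = B" for i
    using that length_sigma_pow_letters[of "Suc k"] by (simp add: bpos_Suc)
  {
    assume cube: "cube_at q (fib (k + 2))"
    then have per: "fib_word j = fib_word (j + fib (k + 2))"
      if "q \<le> j" "j < q + 2 * fib (k + 2)" for j
      using that by (simp add: cube_at_def)
    obtain i t where it: "q = bpos (Suc k) i + t" "t < length ((sigma ^^ Suc k) [fib_word i])"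
      using bpos_cover by blast
    have iB: "fib_word i = B"
    proof (rule ccontr)
      assume "fib_word i \<noteq> B"
      then have iA: "fib_word i = A" by (cases "fib_word i") auto
      then have t: "t < fib (k + 3)"
        using it length_sigma_pow_letters(1)[of "Suc k"] by (simp add: numeral_3_eq_3)
      \<comment> \<open>\<open>N\<close> is the offset of the last position of the block.\<close>
      obtain N where N: "fib (k + 3) = Suc N" using t by (cases "fib (k + 3)") auto
      show False
        using match_in_block(2)[OF iA, of N k] per[of "bpos (Suc k) i + N"] t it(1) N fibs
        by linarith
    qed
    have nextA: "fib_word (Suc i) = A" using fib_word_no_BB iB by blast
    have t: "t < fib (k + 2)"
      using it iB length_sigma_pow_letters(2)[of "Suc k"] by simp
    have "t + 2 \<le> fib (k + 1)"
    proof (rule ccontr)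
      assume "\<not> t + 2 \<le> fib (k + 1)"
      \<comment> \<open>\<open>N\<close> is the offset of the first disagreement in the next block.\<close>
      have "2 \<le> fib (k + 3)" using fibs by linarith
      then obtain N where N: "fib (k + 3) = N + 2" by (metis add.commute le_Suc_ex)
      show False
        using \<open>\<not> t + 2 \<le> fib (k + 1)\<close> match_in_block(2)[OF nextA, of N k] per[of "bpos (Suc k) (Suc i) + N"]
          t it(1) N fibs next_block[OF iB] by linarith
    qed
    then show "\<exists>i t. q = bpos (Suc k) i + t \<and> fib_word i = B \<and> t + 2 \<le> fib (k + 1)"
      using it iB by blast
  }
  {
    assume "\<exists>i t. q = bpos (Suc k) i + t \<and> fib_word i = B \<and> t + 2 \<le> fib (k + 1)"
    then obtain i t where it: "q = bpos (Suc k) i + t" "fib_word i = B" "t + 2 \<le> fib (k + 1)"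
      by blast
    have nextA: "fib_word (Suc i) = A" using fib_word_no_BB it by blast
    show "cube_at q (fib (k + 2))"
      unfolding cube_at_def
    proof (intro conjI allI impI)
      show "0 < fib (k + 2)" using fibs by simp
      fix j assume j: "q \<le> j \<and> j < q + 2 * fib (k + 2)"
      define s where "s = j - bpos (Suc k) i"
      have s: "j = bpos (Suc k) i + s" using j it by (simp add: s_def)
      show "fib_word j = fib_word (j + fib (k + 2))"
      proof (cases "s < fib (k + 2)")
        case True
        then show ?thesis using match_in_block(1)[OF it(2)] s by simp
      next
        case False
        define s' where "s' = s - fib (k + 2)"
        have s': "j = bpos (Suc k) (Suc i) + s'"
          using s False next_block[OF it(2)] by (simp add: s'_def)
        have "s' + 2 < fib (k + 3)" using j it s' next_block[OF it(2)] fibs by linarith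
        then show ?thesis using match_in_block(2)[OF nextA, of s' k] s' by simp
      qed
    qed
  }
qed

section \<open>Counting the cubes in a prefix of Fibonacci length\<close>

lemma subword_fib_word_prefix: "subword fib_word 0 (fib (r + 2)) = (sigma ^^ r) [A]"
  using subword_bpos[of r 0 1] by (simp add: subword_def fib_word_0 length_sigma_pow_letters)

lemma bpos_fib: "bpos k (fib (r + 2)) = fib (k + r + 2)"
proof -
  have "bpos k (fib (r + 2)) = length ((sigma ^^ (k + r)) [A])"
    unfolding bpos_def subword_fib_word_prefix by (simp add: funpow_add)
  then show ?thesis by (simp only: length_sigma_pow_letters)
qed

lemma card_letter_prefix: "card {i. i < n \<and> x i = c} = count_list (subword x 0 n) c"
proof (induction n)
  case (Suc n)
  have "{i. i < Suc n \<and> x i = c} = (if x n = c then insert n {i. i < n \<and> x i = c} else {i. i < n \<and> x i = c})"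
    by (auto simp: less_Suc_eq)
  then show ?case using Suc by (simp add: subword_0_Suc)
qed (simp add: subword_def)

lemma count_B_sigma_pow: "count_list ((sigma ^^ r) [A]) B = fib r"
proof -
  have sum: "count_list w A + count_list w B = length w" for w
  proof (induction w)
    case (Cons c w) then show ?case by (cases c) auto
  qed simp
  show ?thesis
  proof (cases r)
    case (Suc r')
    then have "count_list ((sigma ^^ r) [A]) A = fib (r' + 2)"
      using length_sigma_pow_letters(1)[of r'] by (simp add: count_A_sigma)
    then show ?thesis
      using sum[of "(sigma ^^ r) [A]"] length_sigma_pow_letters(1)[of r] Suc by simp
  qed simp
qed

text \<open>The prefix of length \<open>fib (r + 2)\<close> is \<open>sigma\<^sup>r(A)\<close>, with \<open>fib r\<close> letters \<open>B\<close>. For \<open>r > 0\<close> exactly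
one of them is among the last two letters, which are \<open>AB\<close> or \<open>BA\<close>; for \<open>r = 0\<close> both sides
vanish.\<close>

lemma card_B_prefix: "card {i. i + 3 \<le> fib (r + 2) \<and> fib_word i = B} = fib r - 1"
proof (cases r)
  case 0
  then show ?thesis by simp
next
  case (Suc r')
  obtain u c d where u: "(sigma ^^ r') [A, B] = u @ [c, d]" "c \<noteq> d"
    using sigma_pow_AB_BA by blast
  have r: "(sigma ^^ r) [A] = u @ [c, d]"
    using u Suc by (simp add: funpow_Suc_right del: funpow.simps)
  have lu: "fib (r + 2) = length u + 2"
    using length_sigma_pow_letters(1)[of r] by (simp only: r) simp
  have "subword fib_word 0 (length u) @ subword fib_word (length u) 2 = u @ [c, d]"
    using subword_fib_word_prefix[of r] by (simp only: lu subword_0_add r)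
  then have pre: "subword fib_word 0 (length u) = u" by (simp add: append_eq_append_conv)
  have "count_list u B + 1 = fib r"
    using count_B_sigma_pow[of r] u(2) unfolding r by (cases c; cases d) auto
  moreover have "{i. i + 3 \<le> fib (r + 2) \<and> fib_word i = B} = {i. i < length u \<and> fib_word i = B}"
    using lu by auto
  ultimately show ?thesis by (simp add: card_letter_prefix pre)
qed

text \<open>The prefix is a union of blocks, and the cube ends inside the block of \<open>i + 2\<close>: beyond the end
of the block of \<open>i + 1\<close>, by \<open>fib k + t\<close> positions, which is less than \<open>fib (k + 2)\<close>, the smallest
length of a block.\<close>

lemma cube_fits_iff:
  assumes "fib_word i = B" "t + 2 \<le> fib (k + 1)" "k < m"
  shows "bpos (Suc k) i + t + 3 * fib (k + 2) \<le> fib (m + 2) \<longleftrightarrow> i + 3 \<le> fib (m - 1 - k + 2)"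
proof -
  define r where "r = m - 1 - k"
  have fibs: "fib (k + 3) = fib (k + 2) + fib (k + 1)" "fib (k + 2) = fib (k + 1) + fib k"
    by (simp_all add: numeral_3_eq_3)
  \<comment> \<open>\<open>k = 0\<close> would give \<open>t + 2 \<le> 1\<close>.\<close>
  have "k \<noteq> 0" using assms by (auto intro: ccontr)
  then have "0 < fib k" by (simp add: fib_neq_0_nat)
  have n: "fib (m + 2) = bpos (Suc k) (fib (r + 2))"
    using bpos_fib[of "Suc k" r] assms by (simp add: r_def)
  have nextA: "fib_word (Suc i) = A" using assms fib_word_no_BB by blast
  have i2: "bpos (Suc k) (i + 2) = bpos (Suc k) i + fib (k + 2) + fib (k + 3)"
    using assms(1) nextA length_sigma_pow_letters[of "Suc k"]
    by (simp add: bpos_Suc numeral_2_eq_2 numeral_3_eq_3)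
  have i3: "bpos (Suc k) (i + 2) + fib (k + 2) \<le> bpos (Suc k) (i + 3)"
    using length_sigma_pow_letters[of "Suc k"] bpos_Suc[of "Suc k" "i + 2"]
    by (cases "fib_word (i + 2)") (simp_all add: numeral_3_eq_3)
  show ?thesis
    unfolding r_def[symmetric]
  proof
    assume "bpos (Suc k) i + t + 3 * fib (k + 2) \<le> fib (m + 2)"
    then have "bpos (Suc k) (i + 2) < bpos (Suc k) (fib (r + 2))"
      using i2 fibs \<open>0 < fib k\<close> n by linarith
    then show "i + 3 \<le> fib (r + 2)"
      using strict_mono_less[OF strict_mono_bpos] by fastforce
  next
    assume "i + 3 \<le> fib (r + 2)"
    then have "bpos (Suc k) (i + 3) \<le> bpos (Suc k) (fib (r + 2))"
      using strict_mono_less_eq[OF strict_mono_bpos] by blast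
    then show "bpos (Suc k) i + t + 3 * fib (k + 2) \<le> fib (m + 2)"
      using i2 i3 fibs n assms(2) by linarith
  qed
qed

lemma strict_mono_fib_shift: "strict_mono (\<lambda>k. fib (k + 2))"
  by (simp add: strict_mono_Suc_iff fib_neq_0_nat)

lemma cube_at_period:
  assumes "cube_at q l"
  shows "\<exists>k. l = fib (k + 2)"
proof -
  have "0 < l" "\<And>j. j < l - 1 \<Longrightarrow> fib_word (q + j) = fib_word (q + j + l)"
    using assms by (auto simp: cube_at_def)
  then obtain k where "l = fib (k + 1)" using near_square_period by blast
  then show ?thesis by (cases k) (auto intro: exI[of _ 0])
qed

lemma D_fib: "D (fib (m + 2)) = (\<Sum>k<m. (fib (k + 1) - 1) * (fib (m - 1 - k) - 1))"
proof -
  \<comment> \<open>Parametrise the cubes by the index \<open>k\<close> of the period, the offset \<open>t\<close> and the block \<open>i\<close>.\<close>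
  let ?I = "\<lambda>k. {i. i + 3 \<le> fib (m - 1 - k + 2) \<and> fib_word i = B}"
  let ?T = "\<lambda>k. {t. t + 2 \<le> fib (k + 1)}"
  let ?S = "SIGMA k:{..<m}. ?T k \<times> ?I k"
  let ?h = "\<lambda>(k, t, i). (bpos (Suc k) i + t, fib (k + 2))"
  have short: "t < length ((sigma ^^ Suc k) [fib_word i])" if "fib_word i = B" "t + 2 \<le> fib (k + 1)" for i t k
    using that length_sigma_pow_letters(2)[of "Suc k"] by simp
  have inj: "inj_on ?h ?S"
  proof (rule inj_onI)
    fix c c' assume c: "c \<in> ?S" "c' \<in> ?S" "?h c = ?h c'"
    obtain k t i k' t' i' where tup: "c = (k, t, i)" "c' = (k', t', i')"
      by (cases c, cases c') auto
    have a: "fib_word i = B" "fib_word i' = B" "t + 2 \<le> fib (k + 1)" "t' + 2 \<le> fib (k' + 1)"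
      and eq: "bpos (Suc k) i + t = bpos (Suc k') i' + t'" "fib (k + 2) = fib (k' + 2)"
      using c unfolding tup by auto
    have "k = k'" using strict_mono_eq[OF strict_mono_fib_shift] eq(2) by blast
    moreover have "i = i'" using bpos_unique eq(1) short a \<open>k = k'\<close> by blast
    ultimately show "c = c'" using eq(1) tup by simp
  qed
  have "?h ` ?S = {(q, l). cube_at q l \<and> q + 3 * l \<le> fib (m + 2)}"
  proof (intro equalityI subsetI)
    fix c assume "c \<in> ?h ` ?S"
    then obtain k t i where "k < m" "t \<in> ?T k" "i \<in> ?I k"
      "c = (bpos (Suc k) i + t, fib (k + 2))" by auto
    then show "c \<in> {(q, l). cube_at q l \<and> q + 3 * l \<le> fib (m + 2)}"
      using cube_fits_iff[of i t k m] cube_at_fib_iff by auto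
  next
    fix c assume "c \<in> {(q, l). cube_at q l \<and> q + 3 * l \<le> fib (m + 2)}"
    then obtain q l where c: "c = (q, l)" "cube_at q l" "q + 3 * l \<le> fib (m + 2)" by auto
    obtain k where k: "l = fib (k + 2)" using cube_at_period c by blast
    have "0 < l" using c by (simp add: cube_at_def)
    then have "fib (k + 2) < fib (m + 2)" using c(3) k by linarith
    then have "k < m" using strict_mono_less[OF strict_mono_fib_shift] by blast
    obtain i t where it: "q = bpos (Suc k) i + t" "fib_word i = B" "t + 2 \<le> fib (k + 1)"
      using c(2) k cube_at_fib_iff by blast
    have "i + 3 \<le> fib (m - 1 - k + 2)"
      using cube_fits_iff[OF it(2,3) \<open>k < m\<close>] c(3) k it(1) by blast
    then have "(k, t, i) \<in> ?S" "c = ?h (k, t, i)" using it k c \<open>k < m\<close> by auto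
    then show "c \<in> ?h ` ?S" by blast
  qed
  then have "D (fib (m + 2)) = card ?S"
    using card_image[OF inj] by (simp only: D_eq_card_cube_at)
  also have "\<dots> = (\<Sum>k<m. card (?T k \<times> ?I k))"
  proof (rule card_SigmaI)
    have "finite (?T k)" for k
      by (rule finite_subset[of _ "{..fib (k + 1)}"]) auto
    moreover have "finite (?I k)" for k
      by (rule finite_subset[of _ "{..fib (m - 1 - k + 2)}"]) auto
    ultimately show "\<forall>k\<in>{..<m}. finite (?T k \<times> ?I k)" by blast
  qed simp
  also have "\<dots> = (\<Sum>k<m. (fib (k + 1) - 1) * (fib (m - 1 - k) - 1))"
  proof (rule sum.cong[OF refl])
    fix k
    have "?T k = {..<fib (k + 1) - 1}" by auto
    then have "card (?T k) = fib (k + 1) - 1" by simp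
    then show "card (?T k \<times> ?I k) = (fib (k + 1) - 1) * (fib (m - 1 - k) - 1)"
      by (simp only: card_cartesian_product card_B_prefix)
  qed
  finally show ?thesis .
qed

section \<open>The closed form\<close>

lemma sum_fib: "(\<Sum>k<n. real (fib k)) = real (fib (n + 1)) - 1"
  by (induction n) auto

text \<open>Both sides satisfy the recurrence \<open>C (n + 2) = C (n + 1) + C n + fib (n + 1)\<close>, up to the
factor 5.\<close>

lemma fib_convolution:
  "5 * (\<Sum>k\<le>n. real (fib k) * real (fib (n - k)))
     = real n * (2 * real (fib (n + 1)) - real (fib n)) - real (fib n)"
proof (induction n rule: fib.induct)
  case (3 n)
  let ?C = "\<lambda>n. \<Sum>k\<le>n. real (fib k) * real (fib (n - k))"
  have "(\<Sum>k\<le>n. real (fib k) * real (fib (Suc (Suc n) - k)))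
      = (\<Sum>k\<le>n. real (fib k) * real (fib (Suc n - k))) + ?C n"
    unfolding sum.distrib[symmetric]
    by (intro sum.cong) (auto simp: Suc_diff_le algebra_simps)
  then have "?C (Suc (Suc n)) = ?C (Suc n) + ?C n + real (fib (Suc n))"
    by simp
  then show ?case using 3 by (simp add: algebra_simps)
qed simp_all

lemma D_fib_closed:
  assumes "2 \<le> m"
  shows "5 * real (D (fib (m + 2))) = (real m - 11) * real (fib (m + 1))
    + (real m + 1) * real (fib (m - 1)) + 5 * real m + 5"
proof -
  obtain n where m: "m = Suc (Suc n)" using assms by (metis add_2_eq_Suc le_Suc_ex)
  have "D (fib (m + 2)) = (\<Sum>k<Suc n. (fib (k + 1) - 1) * (fib (Suc n - k) - 1))"
    unfolding D_fib m by simp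
  also have "real \<dots> = (\<Sum>k<Suc n. (real (fib (k + 1)) - 1) * (real (fib (Suc n - k)) - 1))"
    unfolding of_nat_sum
    by (intro sum.cong refl) (simp add: of_nat_diff fib_neq_0_nat Suc_leI)
  also have "\<dots> = (\<Sum>k<Suc n. real (fib (k + 1)) * real (fib (Suc n - k)))
      - (\<Sum>k<Suc n. real (fib (k + 1))) - (\<Sum>k<Suc n. real (fib (Suc n - k))) + real (Suc n)"
    by (simp add: algebra_simps sum.distrib sum_subtractf del: sum.lessThan_Suc)
  also have "(\<Sum>k<Suc n. real (fib (Suc n - k))) = (\<Sum>k<Suc n. real (fib (k + 1)))"
    using sum.nat_diff_reindex[of "\<lambda>k. real (fib (k + 1))" "Suc n"]
    by (simp add: Suc_diff_le del: sum.lessThan_Suc fib.simps)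
  also have "(\<Sum>k<Suc n. real (fib (k + 1))) = real (fib (m + 1)) - 1"
    using sum_fib[of m] unfolding m sum.lessThan_Suc_shift[of _ "Suc n"] by simp
  \<comment> \<open>The extra end terms of the full convolution contain the factor \<open>fib 0 = 0\<close>.\<close>
  also have "(\<Sum>k<Suc n. real (fib (k + 1)) * real (fib (Suc n - k)))
      = (\<Sum>k\<le>m. real (fib k) * real (fib (m - k)))"
    unfolding m lessThan_Suc_atMost[symmetric] sum.lessThan_Suc_shift[of _ "Suc (Suc n)"] by simp
  finally show ?thesis
    using fib_convolution[of m] by (simp add: m algebra_simps)
qed

theorem theorem10p4:
  fixes m :: int
  assumes "m \<ge> 6"
  shows "real (D (f m)) =
    (real_of_int m - 11) / 5 * real (f (m - 1)) +
    (real_of_int m + 1) / 5 * real (f (m - 3)) + real_of_int m + 1"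
proof -
  define n where "n = nat m"
  have m: "m = int n" and n: "6 \<le> n" using assms by (simp_all add: n_def)
  have "nat (m + 2) = n + 2" "nat (m - 1 + 2) = n + 1" "nat (m - 3 + 2) = n - 1"
    using n by (simp_all add: m)
  then have "f m = fib (n + 2)" "f (m - 1) = fib (n + 1)" "f (m - 3) = fib (n - 1)"
    unfolding f_def by (simp_all only:)
  then show ?thesis using D_fib_closed[of n] n by (simp add: m field_simps)
qed

end
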